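(* Let $S$ be a numerical semigroup with multiplicity $3$ and Kunz-coordinates vector $x=(x_1,x_2)\in\mathbb{N}^2$. Then $S$ is decomposable as an intersection of symmetric numerical semigroups with multiplicity $3$ if and only if one of the following conditions holds: \begin{enumerate} \item $S$ is a $3$-symmetric numerical semigroup; \item $S$ is not $3$-irreducible, $x_1$ is odd and $x_2$ is even. \end{enumerate}
   Context: $\mathbb{N}$ denotes the set of non-negative integers. A numerical semigroup is a subset $S\subseteq\mathbb{N}$ that is closed under addition, contains $0$ and has finite complement $\mathbb{N}\setminus S$. The multiplicity of $S$ is the smallest positive integer belonging to $S$, and its Frobenius number $\mathrm{F}(S)$ is the largest integer not belonging to $S$. If $S$ has multiplicity $m$, let $w_i$ be the least element of $S$ congruent to $i$ modulo $m$, for $i=1,\dots,m-1$; the Kunz-coordinates vector of $S$ is $x=(x_1,\dots,x_{m-1})\in\mathbb{N}^{m-1}$ with $x_i=(w_i-i)/m$. A numerical semigroup is irreducible if it cannot be expressed as an intersection of two numerical semigroups containing it properly; it is symmetric if it is irreducible and $\mathrm{F}(S)$ is odd. A numerical semigroup with multiplicity $m$ is $m$-irreducible if it cannot be expressed as an intersection of two numerical semigroups with multiplicity $m$ containing it properly; it is $m$-symmetric if it is $m$-irreducible and $\mathrm{F}(S)$ is odd. Intersections are finite, and an intersection of a single semigroup is allowed. *)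

theory Defs
  imports Main
begin

definition numerical_semigroup :: "nat set \<Rightarrow> bool" where
  "numerical_semigroup S \<longleftrightarrow>
     0 \<in> S \<and> (\<forall>a\<in>S. \<forall>b\<in>S. a + b \<in> S) \<and> finite (- S)"

definition ns_multiplicity :: "nat set \<Rightarrow> nat" where
  "ns_multiplicity S = (LEAST n. n > 0 \<and> n \<in> S)"

text \<open>The Frobenius number is the largest integer (not the largest natural number) outside
  \<open>S\<close>; in particular it is \<open>-1\<close> for \<open>S = UNIV\<close>.\<close>

definition frobenius_number :: "nat set \<Rightarrow> int" where
  "frobenius_number S = (GREATEST z::int. z \<notin> int ` S)"

definition least_congruent :: "nat set \<Rightarrow> nat \<Rightarrow> nat" where
  "least_congruent S i =
     (LEAST w. w \<in> S \<and> w mod ns_multiplicity S = i mod ns_multiplicity S)"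

text \<open>The list of Kunz coordinates \<open>x\<^sub>1, \<dots>, x\<^sub>m\<^sub>-\<^sub>1\<close>, where \<open>m\<close> is the multiplicity. For a numerical
  semigroup and \<open>1 \<le> i < m\<close>, the least element \<open>w\<^sub>i\<close> is at least \<open>i\<close> and congruent to \<open>i\<close> modulo \<open>m\<close>,
  so neither the subtraction nor the division truncates.\<close>

definition kunz_coordinates :: "nat set \<Rightarrow> nat list" where
  "kunz_coordinates S =
     map (\<lambda>i. (least_congruent S i - i) div ns_multiplicity S) [1..<ns_multiplicity S]"

definition irreducible_ns :: "nat set \<Rightarrow> bool" where
  "irreducible_ns S \<longleftrightarrow> numerical_semigroup S \<and>
     \<not> (\<exists>A B. numerical_semigroup A \<and> numerical_semigroup B \<and>
            S \<subset> A \<and> S \<subset> B \<and> S = A \<inter> B)"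

definition symmetric_ns :: "nat set \<Rightarrow> bool" where
  "symmetric_ns S \<longleftrightarrow> irreducible_ns S \<and> odd (frobenius_number S)"

definition m_irreducible_ns :: "nat \<Rightarrow> nat set \<Rightarrow> bool" where
  "m_irreducible_ns m S \<longleftrightarrow> numerical_semigroup S \<and> ns_multiplicity S = m \<and>
     \<not> (\<exists>A B. numerical_semigroup A \<and> ns_multiplicity A = m \<and>
            numerical_semigroup B \<and> ns_multiplicity B = m \<and>
            S \<subset> A \<and> S \<subset> B \<and> S = A \<inter> B)"

definition m_symmetric_ns :: "nat \<Rightarrow> nat set \<Rightarrow> bool" where
  "m_symmetric_ns m S \<longleftrightarrow> m_irreducible_ns m S \<and> odd (frobenius_number S)"

text \<open>The family is nonempty: the empty intersection would be \<open>UNIV\<close>.\<close>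

definition symmetric_decomposable :: "nat \<Rightarrow> nat set \<Rightarrow> bool" where
  "symmetric_decomposable m S \<longleftrightarrow>
     (\<exists>F. finite F \<and> F \<noteq> {} \<and>
          (\<forall>T\<in>F. symmetric_ns T \<and> ns_multiplicity T = m) \<and> S = \<Inter> F)"

end

theory Submission
  imports Defs
begin

text \<open>A numerical semigroup of multiplicity 3 contains every multiple of 3, and in each of the two
  other residue classes everything from its least element on. It is therefore a point \<open>(a, b)\<close> of
  the plane, its vector of Kunz coordinates, and closure under addition amounts to the two
  inequalities \<open>b \<le> 2 * a\<close> and \<open>a \<le> 2 * b + 1\<close> (lemma \<open>numerical_semigroup_kunz3\<close>). In this
  picture reverse inclusion is the product order and intersection is the componentwise maximum.

  A point fails to be 3-irreducible exactly if each coordinate can be lowered by one separately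
  without leaving the region of semigroups of multiplicity 3. So 3-irreducible points lie on or
  next to one of the two boundary lines (lemma \<open>m_irreducible_ns_kunz3_near_boundary\<close>). An odd
  Frobenius number excludes the neighbouring points and leaves the lines \<open>a = 2 * b + 1\<close> and
  \<open>b = 2 * a\<close> themselves (lemma \<open>m_symmetric_ns_kunz3\<close>). Conversely, a point on these lines has the
  reflection property that \<open>z\<close> or \<open>f - z\<close> is an element, where \<open>f\<close> is the Frobenius number. This
  makes it irreducible among all numerical semigroups, whatever their multiplicity
  (lemma \<open>irreducible_ns_of_reflection\<close>).

  If \<open>(a, b)\<close> is the maximum of finitely many boundary points, then one of them has first coordinate
  \<open>a\<close> (lemma \<open>kunz3_Inter_attained\<close>). It is either \<open>(2 * d + 1, d)\<close>, and then \<open>a\<close> is odd, or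
  \<open>(a, 2 * a)\<close>, which forces \<open>b = 2 * a\<close>. In the same way \<open>b\<close> is even or \<open>(a, b)\<close> is itself a boundary
  point. In the other direction, for \<open>a\<close> odd and \<open>b\<close> even the boundary points \<open>(a, (a - 1) / 2)\<close>
  and \<open>(b / 2, b)\<close> have maximum \<open>(a, b)\<close>; only for \<open>a = 1\<close> is the first of them not available, but
  then \<open>(a, b) = (1, 2)\<close> is a boundary point. Finally, \<open>a\<close> odd and \<open>b\<close> even make the Frobenius
  number odd, so that in this case a 3-irreducible semigroup is 3-symmetric.\<close>

section \<open>Semigroups of multiplicity 3 as points of the plane\<close>

text \<open>For \<open>n\<close> congruent to 1 modulo 3, \<open>a \<le> n div 3\<close> means \<open>3 * a + 1 \<le> n\<close>, and for \<open>n\<close> congruent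
  to 2, \<open>b \<le> n div 3\<close> means \<open>3 * b + 2 \<le> n\<close>; so \<open>a\<close> and \<open>b\<close> are the Kunz coordinates.\<close>

definition kunz3 :: "nat \<Rightarrow> nat \<Rightarrow> nat set" where
  "kunz3 a b = {n. (n mod 3 = 1 \<longrightarrow> a \<le> n div 3) \<and> (n mod 3 = 2 \<longrightarrow> b \<le> n div 3)}"

lemma kunz3_mem [simp]:
  "3 * k \<in> kunz3 a b"
  "3 * k + 1 \<in> kunz3 a b \<longleftrightarrow> a \<le> k"
  "Suc (3 * k) \<in> kunz3 a b \<longleftrightarrow> a \<le> k"
  "3 * k + 2 \<in> kunz3 a b \<longleftrightarrow> b \<le> k"
  "Suc (Suc (3 * k)) \<in> kunz3 a b \<longleftrightarrow> b \<le> k"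
proof -
  have "(3 * k + 1) mod 3 = 1" "(3 * k + 1) div 3 = k"
    "(3 * k + 2) mod 3 = 2" "(3 * k + 2) div 3 = k"
    by presburger+
  then show "3 * k \<in> kunz3 a b" "3 * k + 1 \<in> kunz3 a b \<longleftrightarrow> a \<le> k"
    "Suc (3 * k) \<in> kunz3 a b \<longleftrightarrow> a \<le> k" "3 * k + 2 \<in> kunz3 a b \<longleftrightarrow> b \<le> k"
    "Suc (Suc (3 * k)) \<in> kunz3 a b \<longleftrightarrow> b \<le> k"
    by (simp_all add: kunz3_def)
qed

lemma mod3_cases:
  fixes n :: nat
  obtains k where "n = 3 * k" | k where "n = 3 * k + 1" | k where "n = 3 * k + 2"
proof -
  have "\<exists>k. n = 3 * k \<or> n = 3 * k + 1 \<or> n = 3 * k + 2" by presburger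
  then show ?thesis using that by blast
qed

lemma kunz3_subset_iff: "kunz3 a b \<subseteq> kunz3 c d \<longleftrightarrow> c \<le> a \<and> d \<le> b"
proof
  assume sub: "kunz3 a b \<subseteq> kunz3 c d"
  have "3 * a + 1 \<in> kunz3 a b" "3 * b + 2 \<in> kunz3 a b"
    unfolding kunz3_mem by simp_all
  then have "3 * a + 1 \<in> kunz3 c d" "3 * b + 2 \<in> kunz3 c d"
    by (simp_all only: subsetD[OF sub])
  then show "c \<le> a \<and> d \<le> b" unfolding kunz3_mem by simp
next
  assume le: "c \<le> a \<and> d \<le> b"
  show "kunz3 a b \<subseteq> kunz3 c d"
  proof
    fix n assume "n \<in> kunz3 a b"
    with le show "n \<in> kunz3 c d"
      by (cases n rule: mod3_cases) simp_all
  qed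
qed

lemma kunz3_eq_iff: "kunz3 a b = kunz3 c d \<longleftrightarrow> a = c \<and> b = d"
  unfolding set_eq_subset kunz3_subset_iff by auto

lemma kunz3_Int: "kunz3 a b \<inter> kunz3 c d = kunz3 (max a c) (max b d)"
proof (rule set_eqI)
  fix n show "n \<in> kunz3 a b \<inter> kunz3 c d \<longleftrightarrow> n \<in> kunz3 (max a c) (max b d)"
    by (cases n rule: mod3_cases) (simp_all only: Int_iff kunz3_mem max.bounded_iff simp_thms)
qed

text \<open>The two inequalities say that twice the smallest element of a nonzero residue class lies in
  the semigroup. The other sums of elements cause no condition, since \<open>1 + 2\<close> is divisible by 3.\<close>

lemma numerical_semigroup_kunz3:
  "numerical_semigroup (kunz3 a b) \<longleftrightarrow> b \<le> 2 * a \<and> a \<le> 2 * b + 1"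
proof
  assume "numerical_semigroup (kunz3 a b)"
  then have add: "\<And>x y. x \<in> kunz3 a b \<Longrightarrow> y \<in> kunz3 a b \<Longrightarrow> x + y \<in> kunz3 a b"
    by (auto simp: numerical_semigroup_def)
  have "3 * a + 1 + (3 * a + 1) = 3 * (2 * a) + 2" "3 * b + 2 + (3 * b + 2) = 3 * (2 * b + 1) + 1"
    by simp_all
  then show "b \<le> 2 * a \<and> a \<le> 2 * b + 1"
    using add[of "3 * a + 1" "3 * a + 1"] add[of "3 * b + 2" "3 * b + 2"]
    by (simp only: kunz3_mem order_refl simp_thms)
next
  assume ab: "b \<le> 2 * a \<and> a \<le> 2 * b + 1"
  have "x + y \<in> kunz3 a b" if "x \<in> kunz3 a b" "y \<in> kunz3 a b" for x y
  proof -
    have sums: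
      "3 * k + 3 * l = 3 * (k + l)"
      "3 * k + (3 * l + r) = 3 * (k + l) + r"
      "3 * k + r + 3 * l = 3 * (k + l) + r"
      "3 * k + 1 + (3 * l + 1) = 3 * (k + l) + 2"
      "3 * k + 1 + (3 * l + 2) = 3 * (k + l + 1)"
      "3 * k + 2 + (3 * l + 1) = 3 * (k + l + 1)"
      "3 * k + 2 + (3 * l + 2) = 3 * (k + l + 1) + 1" for k l r :: nat
      by simp_all
    show ?thesis
      using that ab
      by (cases x rule: mod3_cases; cases y rule: mod3_cases;
          simp only: sums kunz3_mem; linarith?)
  qed
  moreover have "- kunz3 a b \<subseteq> {..3 * a + 3 * b + 2}"
  proof
    fix n assume "n \<in> - kunz3 a b"
    then show "n \<in> {..3 * a + 3 * b + 2}"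
      by (cases n rule: mod3_cases) auto
  qed
  then have "finite (- kunz3 a b)" by (rule finite_subset) simp
  ultimately show "numerical_semigroup (kunz3 a b)"
    using kunz3_mem(1)[of 0] by (simp add: numerical_semigroup_def)
qed

lemma ns_multiplicity_mem_pos:
  assumes "numerical_semigroup S"
  shows "ns_multiplicity S > 0" "ns_multiplicity S \<in> S"
proof -
  obtain N where "\<And>x. x \<notin> S \<Longrightarrow> x \<le> N"
    using assms unfolding numerical_semigroup_def finite_nat_set_iff_bounded_le by auto
  then have "Suc N > 0 \<and> Suc N \<in> S"
    using not_less_eq_eq by blast
  then have "ns_multiplicity S > 0 \<and> ns_multiplicity S \<in> S"
    unfolding ns_multiplicity_def by (rule LeastI)
  then show "ns_multiplicity S > 0" "ns_multiplicity S \<in> S" by auto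
qed

lemma ns_multiplicity_kunz3: "ns_multiplicity (kunz3 a b) = 3 \<longleftrightarrow> 0 < a \<and> 0 < b"
proof
  assume m: "ns_multiplicity (kunz3 a b) = 3"
  have "1 \<notin> kunz3 a b" "2 \<notin> kunz3 a b"
    using not_less_Least[of 1 "\<lambda>n. n > 0 \<and> n \<in> kunz3 a b"]
      not_less_Least[of 2 "\<lambda>n. n > 0 \<and> n \<in> kunz3 a b"] m
    by (auto simp: ns_multiplicity_def)
  then show "0 < a \<and> 0 < b" by (auto simp: kunz3_def)
next
  assume ab: "0 < a \<and> 0 < b"
  show "ns_multiplicity (kunz3 a b) = 3"
    unfolding ns_multiplicity_def
  proof (rule Least_equality)
    show "(0::nat) < 3 \<and> 3 \<in> kunz3 a b" by (simp add: kunz3_def)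
    show "3 \<le> n" if "0 < n \<and> n \<in> kunz3 a b" for n
      using that ab by (cases n rule: mod3_cases) auto
  qed
qed

lemma add_multiple_mem:
  assumes "numerical_semigroup S" "m \<in> S" "x \<in> S"
  shows "x + k * m \<in> S"
proof (induction k)
  case (Suc k)
  then have "(x + k * m) + m \<in> S"
    using assms by (auto simp: numerical_semigroup_def)
  then show ?case by (simp add: algebra_simps)
qed (use assms in simp)

text \<open>The least element of a residue class determines which elements of that class belong to the
  semigroup, because the multiplicity can be added repeatedly. The class meets the semigroup since
  only finitely many numbers are missing.\<close>

lemma mem_iff_least_congruent_le:
  assumes "numerical_semigroup S"
  shows "least_congruent S i mod ns_multiplicity S = i mod ns_multiplicity S"
    and "n mod ns_multiplicity S = i mod ns_multiplicity S \<Longrightarrow>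
           n \<in> S \<longleftrightarrow> least_congruent S i \<le> n"
proof -
  let ?m = "ns_multiplicity S" and ?w = "least_congruent S i"
  note m = ns_multiplicity_mem_pos[OF assms]
  have "\<exists>w. w \<in> S \<and> w mod ?m = i mod ?m"
  proof -
    obtain N where N: "\<And>x. x \<notin> S \<Longrightarrow> x \<le> N"
      using assms unfolding numerical_semigroup_def finite_nat_set_iff_bounded_le by auto
    have "Suc N * 1 \<le> Suc N * ?m"
      using m(1) by (intro mult_le_mono2) simp
    then have "N < i + Suc N * ?m"
      by (simp only: mult_1_right Suc_le_eq trans_less_add2)
    then have "i + Suc N * ?m \<in> S" using N by (meson not_le)
    moreover have "(i + Suc N * ?m) mod ?m = i mod ?m" by (rule mod_mult_self1)
    ultimately show ?thesis by blast
  qed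
  then have w: "?w \<in> S \<and> ?w mod ?m = i mod ?m"
    unfolding least_congruent_def by (rule LeastI_ex)
  then show "?w mod ?m = i mod ?m" by simp
  assume n: "n mod ?m = i mod ?m"
  show "n \<in> S \<longleftrightarrow> ?w \<le> n"
  proof
    assume "n \<in> S"
    with n show "?w \<le> n"
      unfolding least_congruent_def by (intro Least_le) simp
  next
    assume "?w \<le> n"
    moreover have "n mod ?m = ?w mod ?m" using n w by simp
    ultimately obtain q where "n = ?w + ?m * q"
      by (auto elim: mod_eq_nat1E)
    then show "n \<in> S"
      using add_multiple_mem[OF assms m(2), of ?w q] w by (simp add: mult.commute)
  qed
qed

lemma eq_kunz3:
  assumes S: "numerical_semigroup S" and m: "ns_multiplicity S = 3"
    and k: "kunz_coordinates S = [x1, x2]"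
  shows "S = kunz3 x1 x2"
proof -
  have up: "[1..<3] = [1, 2::nat]" by (simp add: upt_rec)
  have x: "x1 = (least_congruent S 1 - 1) div 3" "x2 = (least_congruent S 2 - 2) div 3"
    using k unfolding kunz_coordinates_def m up by simp_all
  have cong: "least_congruent S 1 mod 3 = 1" "least_congruent S 2 mod 3 = 2"
    using mem_iff_least_congruent_le(1)[OF S, of 1] mem_iff_least_congruent_le(1)[OF S, of 2] m
    by simp_all
  have w: "least_congruent S 1 = 3 * x1 + 1" "least_congruent S 2 = 3 * x2 + 2"
  proof -
    have "n mod 3 = 1 \<Longrightarrow> n = 3 * ((n - 1) div 3) + 1" "n mod 3 = 2 \<Longrightarrow> n = 3 * ((n - 2) div 3) + 2"
      for n :: nat by presburger+
    then show "least_congruent S 1 = 3 * x1 + 1" "least_congruent S 2 = 3 * x2 + 2"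
      using cong unfolding x by blast+
  qed
  have "n \<in> S \<longleftrightarrow> n \<in> kunz3 x1 x2" for n
  proof (cases n rule: mod3_cases)
    case (1 k)
    moreover have "0 + k * 3 \<in> S"
      using add_multiple_mem[OF S, of 3 0 k] ns_multiplicity_mem_pos(2)[OF S] S m
      by (simp add: numerical_semigroup_def)
    ultimately show ?thesis by (metis kunz3_mem(1) add_0 mult.commute)
  next
    case (2 k)
    then have "n mod 3 = 1" by presburger
    then show ?thesis
      using mem_iff_least_congruent_le(2)[OF S, of n 1] m 2 w by simp
  next
    case (3 k)
    then have "n mod 3 = 2" by presburger
    then show ?thesis
      using mem_iff_least_congruent_le(2)[OF S, of n 2] m 3 w by simp
  qed
  then show ?thesis by blast
qed

lemma multiplicity_3_obtains_kunz3:
  assumes "numerical_semigroup S" "ns_multiplicity S = 3"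
  obtains a b where "S = kunz3 a b"
proof -
  have "length (kunz_coordinates S) = 2"
    using assms(2) by (simp add: kunz_coordinates_def)
  then obtain a b where "kunz_coordinates S = [a, b]"
    by (auto simp: numeral_2_eq_2 length_Suc_conv)
  then show ?thesis using eq_kunz3 assms that by blast
qed

section \<open>Frobenius number and symmetry\<close>

lemma frobenius_number_kunz3:
  "frobenius_number (kunz3 a b) = max (3 * int a - 2) (3 * int b - 1)"
  unfolding frobenius_number_def
proof (rule Greatest_equality)
  show "max (3 * int a - 2) (3 * int b - 1) \<notin> int ` kunz3 a b"
  proof
    assume "max (3 * int a - 2) (3 * int b - 1) \<in> int ` kunz3 a b"
    then obtain n where n: "n \<in> kunz3 a b" "int n = max (3 * int a - 2) (3 * int b - 1)"
      by auto
    then consider "int n = 3 * int a - 2" | "int n = 3 * int b - 1" by linarith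
    then show False using n(1) by (cases; cases n rule: mod3_cases) (simp; presburger)+
  qed
  \<comment> \<open>Negative integers lie outside every semigroup, but below the claimed maximum.\<close>
  show "y \<le> max (3 * int a - 2) (3 * int b - 1)" if "y \<notin> int ` kunz3 a b" for y
  proof (cases "y < 0")
    case False
    then obtain n where n: "y = int n" by (metis not_less nonneg_int_cases)
    with that have "n \<notin> kunz3 a b" by blast
    then show ?thesis using n by (cases n rule: mod3_cases) auto
  qed linarith
qed

lemma odd_frobenius_number_kunz3:
  "odd (frobenius_number (kunz3 a b)) \<longleftrightarrow> (if b < a then odd a else even b)"
proof (cases "b < a")
  case True
  then have "frobenius_number (kunz3 a b) = 3 * int a - 2"
    unfolding frobenius_number_kunz3 by linarith
  with True show ?thesis by simp
next
  case False
  then have "frobenius_number (kunz3 a b) = 3 * int b - 1"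
    unfolding frobenius_number_kunz3 by linarith
  with False show ?thesis by simp
qed

text \<open>A proper oversemigroup contains some gap \<open>z\<close> and also \<open>f - z\<close>, hence \<open>f\<close>. So all proper
  oversemigroups share \<open>f\<close>, and no two of them intersect in \<open>S\<close>.\<close>

lemma irreducible_ns_of_reflection:
  assumes "numerical_semigroup S" "f \<notin> S"
    and refl: "\<And>z. z \<notin> S \<Longrightarrow> z \<le> f \<and> f - z \<in> S"
  shows "irreducible_ns S"
proof -
  have "f \<in> A" if A: "numerical_semigroup A" "S \<subset> A" for A
  proof -
    obtain z where z: "z \<in> A" "z \<notin> S" using A(2) by blast
    then have "z + (f - z) \<in> A"
      using A refl[OF z(2)] unfolding numerical_semigroup_def by blast
    then show ?thesis using refl[OF z(2)] by simp
  qed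
  then show ?thesis using assms(1,2) unfolding irreducible_ns_def by blast
qed

text \<open>The Frobenius numbers are \<open>6 * b + 1\<close> and \<open>6 * a - 1\<close>. They are written as \<open>3 * k + r\<close> with
  \<open>r < 3\<close>, so that membership of their reflections can be read off from the coordinates. On either
  line a gap in one residue class is reflected to a multiple of 3, and a gap in the other class stays
  in that class.\<close>

lemma irreducible_ns_kunz3_boundary:
  assumes "0 < a" "0 < b" "a = 2 * b + 1 \<or> b = 2 * a"
  shows "irreducible_ns (kunz3 a b)"
  using assms(3)
proof
  assume a: "a = 2 * b + 1"
  show ?thesis
  proof (rule irreducible_ns_of_reflection[where f = "3 * (2 * b) + 1"])
    show "numerical_semigroup (kunz3 a b)" using a by (simp add: numerical_semigroup_kunz3)
    show "3 * (2 * b) + 1 \<notin> kunz3 a b" unfolding kunz3_mem using a by simp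
    show "z \<le> 3 * (2 * b) + 1 \<and> 3 * (2 * b) + 1 - z \<in> kunz3 a b" if "z \<notin> kunz3 a b" for z
    proof (cases z rule: mod3_cases)
      case (2 k)
      then have "z \<le> 3 * (2 * b) + 1" "3 * (2 * b) + 1 - z = 3 * (2 * b - k)"
        using that a by simp_all
      then show ?thesis by simp
    next
      case (3 k)
      then have "k < b" using that by simp
      with 3 have "z \<le> 3 * (2 * b) + 1" "3 * (2 * b) + 1 - z = 3 * (2 * b - k - 1) + 2"
        by linarith+
      then show ?thesis using \<open>k < b\<close> by simp
    qed (use that in simp)
  qed
next
  assume b: "b = 2 * a"
  show ?thesis
  proof (rule irreducible_ns_of_reflection[where f = "3 * (2 * a - 1) + 2"])
    show "numerical_semigroup (kunz3 a b)" using b by (simp add: numerical_semigroup_kunz3)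
    show "3 * (2 * a - 1) + 2 \<notin> kunz3 a b"
      unfolding kunz3_mem using assms(1) b by simp
    show "z \<le> 3 * (2 * a - 1) + 2 \<and> 3 * (2 * a - 1) + 2 - z \<in> kunz3 a b"
      if "z \<notin> kunz3 a b" for z
    proof (cases z rule: mod3_cases)
      case (2 k)
      then have "k < a" using that by simp
      with 2 have "z \<le> 3 * (2 * a - 1) + 2" "3 * (2 * a - 1) + 2 - z = 3 * (2 * a - 1 - k) + 1"
        by linarith+
      then show ?thesis using \<open>k < a\<close> by simp
    next
      case (3 k)
      then have "z \<le> 3 * (2 * a - 1) + 2" "3 * (2 * a - 1) + 2 - z = 3 * (2 * a - 1 - k)"
        using that b by simp_all
      then show ?thesis by simp
    qed (use that in simp)
  qed
qed

text \<open>If each coordinate can be lowered by one separately without leaving the region of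
  semigroups of multiplicity 3, the two resulting points have the original point as their maximum.\<close>

lemma m_irreducible_ns_kunz3_near_boundary:
  assumes "m_irreducible_ns 3 (kunz3 a b)"
  shows "2 * b \<le> a \<or> 2 * a \<le> b + 1"
proof (rule ccontr)
  assume far: "\<not> (2 * b \<le> a \<or> 2 * a \<le> b + 1)"
  have ns: "numerical_semigroup (kunz3 a b)" and m: "ns_multiplicity (kunz3 a b) = 3"
    using assms by (auto simp: m_irreducible_ns_def)
  have pos: "0 < a" "0 < b" using m by (auto simp: ns_multiplicity_kunz3)
  have bounds: "b \<le> 2 * a" "a \<le> 2 * b + 1" using ns by (auto simp: numerical_semigroup_kunz3)
  let ?A = "kunz3 (a - 1) b" and ?B = "kunz3 a (b - 1)"
  have "numerical_semigroup ?A" "numerical_semigroup ?B"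
    unfolding numerical_semigroup_kunz3 using far pos bounds by linarith+
  moreover have "ns_multiplicity ?A = 3" "ns_multiplicity ?B = 3"
    unfolding ns_multiplicity_kunz3 using far pos bounds by linarith+
  moreover have "kunz3 a b \<subset> ?A" "kunz3 a b \<subset> ?B"
    using pos by (auto simp: psubset_eq kunz3_subset_iff kunz3_eq_iff)
  moreover have "kunz3 a b = ?A \<inter> ?B" by (simp add: kunz3_Int)
  ultimately show False using assms unfolding m_irreducible_ns_def by blast
qed

lemma m_irreducible_of_irreducible:
  "irreducible_ns S \<Longrightarrow> m_irreducible_ns (ns_multiplicity S) S"
  unfolding irreducible_ns_def m_irreducible_ns_def by blast

text \<open>The points \<open>(2 * b, b)\<close> and \<open>(a, 2 * a - 1)\<close> next to the boundary are excluded by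
  their even Frobenius numbers.\<close>

lemma m_symmetric_ns_kunz3:
  assumes "numerical_semigroup (kunz3 a b)" "ns_multiplicity (kunz3 a b) = 3"
  shows "m_symmetric_ns 3 (kunz3 a b) \<longleftrightarrow> a = 2 * b + 1 \<or> b = 2 * a"
    and "symmetric_ns (kunz3 a b) \<longleftrightarrow> a = 2 * b + 1 \<or> b = 2 * a"
proof -
  have pos: "0 < a" "0 < b" using assms(2) by (auto simp: ns_multiplicity_kunz3)
  have bounds: "b \<le> 2 * a" "a \<le> 2 * b + 1"
    using assms(1) by (auto simp: numerical_semigroup_kunz3)
  have 1: "a = 2 * b + 1 \<or> b = 2 * a" if "m_symmetric_ns 3 (kunz3 a b)"
  proof -
    have parity: "if b < a then odd a else even b"
      using that odd_frobenius_number_kunz3 by (simp add: m_symmetric_ns_def)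
    have "2 * b \<le> a \<or> 2 * a \<le> b + 1"
      using that m_irreducible_ns_kunz3_near_boundary by (simp add: m_symmetric_ns_def)
    then show ?thesis
    proof
      assume "2 * b \<le> a"
      moreover from this have "a \<noteq> 2 * b" using parity pos by auto
      ultimately show ?thesis using bounds by linarith
    next
      assume le: "2 * a \<le> b + 1"
      then have "even b" using parity pos by (simp split: if_splits)
      then have "b + 1 \<noteq> 2 * a" by (metis dvd_triv_left even_plus_one_iff)
      then show ?thesis using le bounds by linarith
    qed
  qed
  have 2: "symmetric_ns (kunz3 a b)" if "a = 2 * b + 1 \<or> b = 2 * a"
    using irreducible_ns_kunz3_boundary[OF pos that] that pos
    by (auto simp: symmetric_ns_def odd_frobenius_number_kunz3)
  have 3: "m_symmetric_ns 3 (kunz3 a b)" if "symmetric_ns (kunz3 a b)"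
    using that m_irreducible_of_irreducible assms(2)
    by (metis m_symmetric_ns_def symmetric_ns_def)
  show "m_symmetric_ns 3 (kunz3 a b) \<longleftrightarrow> a = 2 * b + 1 \<or> b = 2 * a"
    and "symmetric_ns (kunz3 a b) \<longleftrightarrow> a = 2 * b + 1 \<or> b = 2 * a"
    using 1 2 3 by blast+
qed

section \<open>Decomposition into symmetric semigroups\<close>

text \<open>The first coordinate of an intersection is attained by a member of the family, because
  some member omits \<open>3 * a - 2\<close>, the largest gap congruent to 1 modulo 3. The second coordinate is
  attained by a member that omits \<open>3 * b - 1\<close>.\<close>

lemma kunz3_Inter_attained:
  assumes "\<Inter> F = kunz3 a b" "0 < a" "0 < b"
    and "\<And>T. T \<in> F \<Longrightarrow> \<exists>c d. T = kunz3 c d"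
  obtains c d where "kunz3 a d \<in> F" "d \<le> b" "kunz3 c b \<in> F" "c \<le> a"
proof -
  have le: "c \<le> a \<and> d \<le> b" if "kunz3 c d \<in> F" for c d
    using that assms(1) kunz3_subset_iff by blast
  have "3 * (a - 1) + 1 \<notin> \<Inter> F" "3 * (b - 1) + 2 \<notin> \<Inter> F"
    unfolding assms(1) kunz3_mem using assms(2,3) by simp_all
  then obtain T U where T: "T \<in> F" "3 * (a - 1) + 1 \<notin> T" and U: "U \<in> F" "3 * (b - 1) + 2 \<notin> U"
    by blast
  obtain a' d where T': "T = kunz3 a' d" using assms(4) T(1) by blast
  obtain c b' where U': "U = kunz3 c b'" using assms(4) U(1) by blast
  have "a' \<le> a" "d \<le> b" "b' \<le> b" "c \<le> a" using le T(1) U(1) T' U' by blast+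
  moreover have "a - 1 < a'" "b - 1 < b'"
    using T(2) U(2) unfolding T' U' kunz3_mem by simp_all
  ultimately have "a' = a" "b' = b" by linarith+
  then show ?thesis using that T(1) U(1) T' U' \<open>d \<le> b\<close> \<open>c \<le> a\<close> by blast
qed

lemma symmetric_decomposable_kunz3:
  assumes S: "numerical_semigroup (kunz3 a b)" "ns_multiplicity (kunz3 a b) = 3"
  shows "symmetric_decomposable 3 (kunz3 a b) \<longleftrightarrow>
           a = 2 * b + 1 \<or> b = 2 * a \<or> (odd a \<and> even b)"
proof -
  have pos: "0 < a" "0 < b" using S(2) by (auto simp: ns_multiplicity_kunz3)
  have bounds: "b \<le> 2 * a" "a \<le> 2 * b + 1"
    using S(1) by (auto simp: numerical_semigroup_kunz3)
  show ?thesis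
  proof
    assume "symmetric_decomposable 3 (kunz3 a b)"
    then obtain F where sym: "\<And>T. T \<in> F \<Longrightarrow> symmetric_ns T \<and> ns_multiplicity T = 3"
      and F: "\<Inter> F = kunz3 a b"
      unfolding symmetric_decomposable_def by auto
    have ns: "numerical_semigroup T" if "T \<in> F" for T
      using sym[OF that] by (simp add: symmetric_ns_def irreducible_ns_def)
    obtain c d where cd: "kunz3 a d \<in> F" "d \<le> b" "kunz3 c b \<in> F" "c \<le> a"
      using kunz3_Inter_attained[OF F pos] multiplicity_3_obtains_kunz3 sym ns by metis
    have "a = 2 * d + 1 \<or> d = 2 * a" "c = 2 * b + 1 \<or> b = 2 * c"
      using m_symmetric_ns_kunz3(2) sym ns cd(1,3) by blast+
    then show "a = 2 * b + 1 \<or> b = 2 * a \<or> (odd a \<and> even b)"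
    proof (elim disjE)
      assume "a = 2 * d + 1" "b = 2 * c"
      then show ?thesis by simp
    qed (use cd(2,4) bounds in linarith)+
  next
    assume ab: "a = 2 * b + 1 \<or> b = 2 * a \<or> (odd a \<and> even b)"
    show "symmetric_decomposable 3 (kunz3 a b)"
    proof (cases "a = 2 * b + 1 \<or> b = 2 * a")
      case True
      then have "symmetric_ns (kunz3 a b)" using m_symmetric_ns_kunz3(2)[OF S] by blast
      then show ?thesis
        unfolding symmetric_decomposable_def using S(2) by (intro exI[of _ "{kunz3 a b}"]) simp
    next
      case False
      with ab have "odd a" "even b" by auto
      then obtain c d where c: "a = 2 * d + 1" and d: "b = 2 * c"
        by (metis oddE evenE)
      \<comment> \<open>\<open>d = 0\<close> would give \<open>a = 1\<close> and hence \<open>b = 2 = 2 * a\<close>.\<close>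
      have "0 < d" using False c d pos bounds by (cases "d = 0") auto
      with c d pos bounds have cd: "0 < c" "0 < d" "c \<le> a" "d \<le> b" by simp_all
      have "symmetric_ns T \<and> ns_multiplicity T = 3" if "T \<in> {kunz3 a d, kunz3 c b}" for T
      proof -
        have "numerical_semigroup (kunz3 a d)" "ns_multiplicity (kunz3 a d) = 3"
          "numerical_semigroup (kunz3 c b)" "ns_multiplicity (kunz3 c b) = 3"
          unfolding numerical_semigroup_kunz3 ns_multiplicity_kunz3 using c d cd by simp_all
        then show ?thesis using that m_symmetric_ns_kunz3(2) c d by blast
      qed
      moreover have "kunz3 a b = \<Inter> {kunz3 a d, kunz3 c b}"
        using cd by (simp add: kunz3_Int max_def)
      ultimately show ?thesis
        unfolding symmetric_decomposable_def by (intro exI[of _ "{kunz3 a d, kunz3 c b}"]) simp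
    qed
  qed
qed

theorem corollary18:
  fixes S :: "nat set" and x1 x2 :: nat
  assumes "numerical_semigroup S"
    and "ns_multiplicity S = 3"
    and "kunz_coordinates S = [x1, x2]"
  shows "symmetric_decomposable 3 S \<longleftrightarrow>
           m_symmetric_ns 3 S \<or> (\<not> m_irreducible_ns 3 S \<and> odd x1 \<and> even x2)"
proof -
  have S: "S = kunz3 x1 x2" using eq_kunz3 assms by blast
  have "m_symmetric_ns 3 S" if "m_irreducible_ns 3 S" "odd x1" "even x2"
    using that S by (simp add: m_symmetric_ns_def odd_frobenius_number_kunz3)
  then show ?thesis
    using symmetric_decomposable_kunz3 m_symmetric_ns_kunz3(1) assms(1,2) unfolding S by blast
qed

end
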